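(* Let $a\in\mathbb{R}\setminus\{0,1\}$. Let $R_0(x)=1$, $R_1(x)=x$ and, for $n\geq 1$, $R_{n+1}(x)=xR_n(x)-\frac{a}{n}(1-x^2)R_n'(x)$; let $S_n(x)=(-i)^nR_n(ix)$ for $n\geq 0$, where $i$ is the imaginary unit. Then the sequence $(R_n)_{n\geq 0}$ is not a sequence of orthogonal polynomials, and the sequence $(S_n)_{n\geq 0}$ is not a sequence of orthogonal polynomials.
   Context: A sequence $(P_n)_{n\geq 0}$ of real polynomials is called a sequence of orthogonal polynomials if $\deg P_n=n$ for all $n\geq 0$ and there exists a positive Borel measure $\mu$ on $\mathbb{R}$ with infinite support and finite moments of all orders such that $\int_{\mathbb{R}}P_m(x)P_n(x)\,\mathrm{d}\mu(x)=0$ for all $m\neq n$. The polynomials $S_n$ have real coefficients. *)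

theory Defs
  imports "HOL-Analysis.Analysis" "HOL-Computational_Algebra.Polynomial"
begin

definition measure_support :: "'a::topological_space measure \<Rightarrow> 'a set" where
  "measure_support \<mu> = {x. \<forall>U. open U \<longrightarrow> x \<in> U \<longrightarrow> emeasure \<mu> U > 0}"

(* "P n \<noteq> 0" only matters for n = 0, because the library sets degree 0 = 0. *)
definition orthogonal_polynomials :: "(nat \<Rightarrow> real poly) \<Rightarrow> bool" where
  "orthogonal_polynomials P \<longleftrightarrow>
     (\<forall>n. P n \<noteq> 0 \<and> degree (P n) = n) \<and>
     (\<exists>\<mu> :: real measure.
        sets \<mu> = sets borel \<and>
        infinite (measure_support \<mu>) \<and>
        (\<forall>k::nat. integrable \<mu> (\<lambda>x. x ^ k)) \<and>
        (\<forall>m n. m \<noteq> n \<longrightarrow> (LINT x|\<mu>. poly (P m) x * poly (P n) x) = 0))"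

fun R :: "real \<Rightarrow> nat \<Rightarrow> real poly" where
  "R a 0 = 1"
| "R a (Suc 0) = [:0, 1:]"
| "R a (Suc (Suc n)) = [:0, 1:] * R a (Suc n)
     - smult (a / real (Suc n)) ([:1, 0, -1:] * pderiv (R a (Suc n)))"

lemma R_rec:
  assumes "n \<ge> 1"
  shows "R a (n + 1) = [:0, 1:] * R a n - smult (a / real n) ([:1, 0, -1:] * pderiv (R a n))"
  using assms by (cases n) auto

definition S_complex :: "real \<Rightarrow> nat \<Rightarrow> complex poly" where
  "S_complex a n = smult ((-\<i>) ^ n) (map_poly complex_of_real (R a n) \<circ>\<^sub>p [:0, \<i>:])"

lemma poly_S_complex:
  "poly (S_complex a n) z = (-\<i>) ^ n * poly (map_poly complex_of_real (R a n)) (\<i> * z)"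
  by (simp add: S_complex_def poly_pcompose mult.commute)

(* Taking real parts loses nothing: all coefficients are real, see of_real_S below. *)
definition S :: "real \<Rightarrow> nat \<Rightarrow> real poly" where
  "S a n = map_poly Re (S_complex a n)"

lemma coeff_R_odd: "odd (n + k) \<Longrightarrow> coeff (R a n) k = 0"
proof (induction a n arbitrary: k rule: R.induct)
  case (1 a)
  then show ?case by (cases k) auto
next
  case (2 a)
  then show ?case by (auto simp: coeff_pCons split: nat.splits)
next
  case (3 a n)
  have eq: "[:1, 0, -1:] * p = p - pCons 0 (pCons 0 p)" for p :: "real poly"
    by simp
  show ?case using 3
    by (auto simp: eq coeff_pCons coeff_pderiv split: nat.splits)
qed

lemma of_real_S: "map_poly complex_of_real (S a n) = S_complex a n"
proof (rule poly_eqI)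
  fix k
  have "coeff (S_complex a n) k \<in> \<real>"
  proof (cases "odd (n + k)")
    case True
    then show ?thesis
      by (simp add: S_complex_def coeff_pcompose_linear coeff_map_poly coeff_R_odd)
  next
    case False
    then obtain j where j: "n + k = 2 * j" by (metis evenE)
    have "(-\<i>) ^ n * \<i> ^ k = (-1) ^ n * \<i> ^ (n + k)"
      by (simp add: power_add power_minus[of "\<i>"])
    also have "\<dots> = (-1) ^ n * (-1) ^ j"
      by (simp add: j power_mult)
    finally have "(-\<i>) ^ n * \<i> ^ k \<in> \<real>" by simp
    then have "((-\<i>) ^ n * \<i> ^ k) * of_real (coeff (R a n) k) \<in> \<real>"
      by (rule Reals_mult) simp
    then show ?thesis
      by (simp add: S_complex_def coeff_pcompose_linear coeff_map_poly mult.assoc)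
  qed
  then show "coeff (map_poly complex_of_real (S a n)) k = coeff (S_complex a n) k"
    by (simp add: S_def coeff_map_poly)
qed

end

theory Submission
  imports Defs
begin

text \<open>
  Orthogonality of the pairs \<open>(2,0)\<close>, \<open>(3,1)\<close> and \<open>(4,0)\<close> gives three homogeneous linear
  equations for the moments of orders 0, 2 and 4. Eliminating the last two moments leaves
  \<open>a\<^sup>2 (a - 1) m\<^sub>0 = 0\<close>, and \<open>m\<^sub>0 > 0\<close> because the support is nonempty.
  Passing from \<open>R\<close> to \<open>S\<close> only changes the sign of every second coefficient.
\<close>

lemma integrable_poly_of_moments:
  fixes \<mu> :: "real measure"
  assumes "\<And>k::nat. integrable \<mu> (\<lambda>x. x ^ k)"
  shows "integrable \<mu> (poly p)"
  unfolding poly_altdef by (intro Bochner_Integration.integrable_sum integrable_mult_right assms)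

text \<open>Used as a rewrite rule, it peels off one coefficient at a time until the zero polynomial
  remains, turning the integral of an explicit polynomial into a combination of moments.\<close>

lemma integral_poly_pCons:
  fixes \<mu> :: "real measure"
  assumes "\<And>k::nat. integrable \<mu> (\<lambda>x. x ^ k)"
  shows "(LINT x|\<mu>. x ^ j * poly (pCons c p) x) =
    c * (LINT x|\<mu>. x ^ j) + (LINT x|\<mu>. x ^ Suc j * poly p x)"
proof -
  have "poly (monom 1 (Suc j) * p) = (\<lambda>x. x ^ Suc j * poly p x)"
    by (auto simp: poly_monom)
  then have "integrable \<mu> (\<lambda>x. x ^ Suc j * poly p x)"
    using integrable_poly_of_moments[OF assms, of "monom 1 (Suc j) * p"] by metis
  then have "(LINT x|\<mu>. c * x ^ j + x ^ Suc j * poly p x) =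
      c * (LINT x|\<mu>. x ^ j) + (LINT x|\<mu>. x ^ Suc j * poly p x)"
    using assms by simp
  then show ?thesis by (simp add: algebra_simps)
qed

lemma moment_0_pos:
  fixes \<mu> :: "real measure"
  assumes "sets \<mu> = sets borel" and "measure_support \<mu> \<noteq> {}" and "integrable \<mu> (\<lambda>x. x ^ 0)"
  shows "(LINT x|\<mu>. x ^ 0) > 0"
proof -
  have space: "space \<mu> = UNIV"
    using sets_eq_imp_space_eq[OF assms(1)] by simp
  from assms(2) have "emeasure \<mu> UNIV > 0"
    unfolding measure_support_def by blast
  \<comment> \<open>Finiteness matters: \<open>measure\<close> sends infinite mass to 0.\<close>
  moreover have "emeasure \<mu> UNIV < \<infinity>"
    using assms(3) space by (simp add: integrable_iff_bounded)
  ultimately show ?thesis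
    by (simp add: space measure_def enn2real_positive_iff)
qed

text \<open>The parameter \<open>s\<close> treats both families at once: \<open>s = 1\<close> gives
  \<open>R\<close> and \<open>s = -1\<close> gives \<open>S\<close>. Each descent by two degrees
  contributes one factor \<open>s\<close>.\<close>

lemma not_orthogonal_polynomials:
  fixes a s :: real
  assumes P: "P 0 = 1" "P 1 = [:0, 1:]" "P 2 = [:- s * a, 0, 1 + a:]"
      "P 3 = [:0, - s * a * (2 + a), 0, (1 + a)\<^sup>2:]"
      "P 4 = [:s\<^sup>2 * a\<^sup>2 * (2 + a) / 3, 0, - s * a * (4 * a\<^sup>2 + 11 * a + 9) / 3, 0, (1 + a) ^ 3:]"
    and nz: "s \<noteq> 0" "a \<noteq> 0" "a \<noteq> 1"
  shows "\<not> orthogonal_polynomials P"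
proof
  assume "orthogonal_polynomials P"
  then obtain \<mu> :: "real measure" where \<mu>: "sets \<mu> = sets borel" "infinite (measure_support \<mu>)"
      and int: "\<And>k::nat. integrable \<mu> (\<lambda>x. x ^ k)"
      and orth: "\<And>m n. m \<noteq> n \<Longrightarrow> (LINT x|\<mu>. poly (P m) x * poly (P n) x) = 0"
    unfolding orthogonal_polynomials_def by blast
  define M where "M k = (LINT x|\<mu>. x ^ k)" for k :: nat
  have pc: "(LINT x|\<mu>. x ^ j * poly (pCons c p) x) = c * M j + (LINT x|\<mu>. x ^ Suc j * poly p x)" for j c p
    using integral_poly_pCons[OF int] by (simp add: M_def)
  \<comment> \<open>The power \<open>x ^ 0\<close> stands for \<open>P 0\<close>, as
    \<open>x ^ 1\<close> does for \<open>P 1\<close> below, so that \<open>pc\<close>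
    applies.\<close>
  have "(LINT x|\<mu>. x ^ 0 * poly (P 2) x) = 0"
    using orth[of 0 2] P(1) by simp
  then have e2: "(1 + a) * M 2 = s * a * M 0"
    unfolding P pc by (simp add: numeral_eq_Suc)
  have "(LINT x|\<mu>. x ^ 1 * poly (P 3) x) = 0"
    using orth[of 1 3] P(2) by simp
  then have e3: "(1 + a)\<^sup>2 * M 4 = s * a * (2 + a) * M 2"
    unfolding P pc by (simp add: numeral_eq_Suc)
  have "(LINT x|\<mu>. x ^ 0 * poly (P 4) x) = 0"
    using orth[of 0 4] P(1) by simp
  then have e4: "s\<^sup>2 * a\<^sup>2 * (2 + a) * M 0 - s * a * (4 * a\<^sup>2 + 11 * a + 9) * M 2
      + 3 * (1 + a) ^ 3 * M 4 = 0"
    unfolding P pc by (simp add: numeral_eq_Suc field_simps)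
  \<comment> \<open>By \<open>e3\<close> and then \<open>e2\<close>, the last term of
    \<open>e4\<close> is \<open>3 * s^2 * a^2 * (2 + a) * M 0\<close>. Since
    \<open>4 * a^2 + 11 * a + 9 = (1 + a) * (4 * a + 7) + 2\<close>, \<open>e2\<close> reduces
    \<open>e4\<close> to \<open>s^2 * a^2 * M 0 = 2 * s * a * M 2\<close>. Multiplying by
    \<open>1 + a\<close> and using \<open>e2\<close> again finishes. Nothing is divided by
    \<open>1 + a\<close>, so \<open>a = -1\<close> is covered.\<close>
  have "s\<^sup>2 * a\<^sup>2 * (a - 1) * M 0 = 0"
    using e2 e3 e4 by algebra
  moreover have "M 0 > 0"
    unfolding M_def using \<mu> by (intro moment_0_pos int) auto
  ultimately show False using nz by simp
qed

lemma R_2: "R a 2 = [:- a, 0, 1 + a:]"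
  by (simp add: eval_nat_numeral pderiv_pCons)

lemma R_3: "R a 3 = [:0, - a * (2 + a), 0, (1 + a)\<^sup>2:]"
proof -
  have "R a 3 = R a (2 + 1)" by simp
  also have "\<dots> = [:0, - a * (2 + a), 0, (1 + a)\<^sup>2:]"
    by (subst R_rec) (simp_all add: R_2 pderiv_pCons power2_eq_square field_simps)
  finally show ?thesis .
qed

lemma R_4: "R a 4 =
    [:a\<^sup>2 * (2 + a) / 3, 0, - a * (4 * a\<^sup>2 + 11 * a + 9) / 3, 0, (1 + a) ^ 3:]"
  (is "_ = ?p")
proof -
  have "R a 4 = R a (3 + 1)" by simp
  also have "\<dots> = ?p"
    by (subst R_rec) (simp_all add: R_3 pderiv_pCons power2_eq_square power3_eq_cube field_simps)
  finally show ?thesis .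
qed

text \<open>For \<open>k\<close> at most \<open>n\<close> the complex factor is the power
  \<open>n - k\<close> of \<open>-\<i>\<close>, because \<open>-\<i> * \<i> = 1\<close>. Hence
  leading coefficients agree and signs alternate in steps of two degrees.\<close>

lemma coeff_S: "coeff (S a n) k = Re ((-\<i>) ^ n * \<i> ^ k) * coeff (R a n) k"
proof -
  have "coeff (S a n) k = Re ((-\<i>) ^ n * \<i> ^ k * of_real (coeff (R a n) k))"
    by (simp add: S_def S_complex_def coeff_pcompose_linear coeff_map_poly mult_ac)
  then show ?thesis by simp
qed

theorem proposition3:
  fixes a :: real
  assumes "a \<noteq> 0" and "a \<noteq> 1"
  shows "\<not> orthogonal_polynomials (R a) \<and> \<not> orthogonal_polynomials (S a)"
proof
  show "\<not> orthogonal_polynomials (R a)"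
    using assms R_2 R_3 R_4 by (intro not_orthogonal_polynomials[of _ 1 a]) simp_all
  have S: "S a 0 = 1" "S a 1 = [:0, 1:]" "S a 2 = [:a, 0, 1 + a:]"
      "S a 3 = [:0, a * (2 + a), 0, (1 + a)\<^sup>2:]"
      "S a 4 = [:a\<^sup>2 * (2 + a) / 3, 0, a * (4 * a\<^sup>2 + 11 * a + 9) / 3, 0, (1 + a) ^ 3:]"
    by (rule_tac [!] poly_eqI)
      (auto simp: coeff_S R_2 R_3 R_4 coeff_1 coeff_pCons power_numeral_even power_numeral_odd
        split: nat.split intro: gr0I)
  show "\<not> orthogonal_polynomials (S a)"
    using assms S by (intro not_orthogonal_polynomials[of _ "-1" a]) simp_all
qed

end
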